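(* For each positive integer $k$, there exists a Hamiltonian (i.e. closed) Euclidean wazir's tour on $C(2,k)=\{0,1\}^k$; that is, there exists an ordering $V_1,V_2,\dots,V_{2^k}$ of all the elements of $\{0,1\}^k$, each occurring exactly once, such that $\|V_i-V_{i+1}\|=1$ for every $1\le i\le 2^k-1$ and $\|V_{2^k}-V_1\|=1$.
   Context: For positive integers $n,k$, $C(n,k):=\{0,1,\dots,n-1\}^k$ and $\|\cdot\|$ is the Euclidean norm on $\mathbb{R}^k$. The $(a,b)$-leaper is the fairy chess piece that may jump between any two vertices of $C(n,k)$ whose Euclidean distance is exactly $\sqrt{a^2+b^2}$. The wazir is the $(0,1)$-leaper, so its jump length is $\sqrt{0^2+1^2}=1$. A Euclidean tour of a leaper on $C(n,k)$ is a sequence listing every vertex of $C(n,k)$ exactly once in which any two consecutive vertices are at the leaper's jump distance. It is closed (Hamiltonian) if the last and the first vertices are also at the leaper's jump distance. In particular, for $k=1$ the sequence $(0),(1)$ counts as a closed tour. *)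

theory Defs
  imports "HOL-Analysis.Analysis"
begin

text \<open>The dimension \<open>k\<close> of the board \<open>C(n,k)\<close> is \<open>CARD('k)\<close>, which is automatically positive;
  \<open>dist\<close> on \<^typ>\<open>real ^ 'k\<close> is the Euclidean distance.\<close>

definition board :: "nat \<Rightarrow> (real ^ 'k) set" where
  "board n = {x. \<forall>i. x $ i \<in> real ` {0..<n}}"

definition leaper_jump :: "nat \<Rightarrow> nat \<Rightarrow> real ^ 'k \<Rightarrow> real ^ 'k \<Rightarrow> bool" where
  "leaper_jump a b v w \<longleftrightarrow> dist v w = sqrt (real a ^ 2 + real b ^ 2)"

definition euclidean_tour :: "nat \<Rightarrow> nat \<Rightarrow> nat \<Rightarrow> (real ^ 'k) list \<Rightarrow> bool" where
  "euclidean_tour a b n Vs \<longleftrightarrow>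
     distinct Vs \<and> set Vs = board n \<and>
     (\<forall>i. Suc i < length Vs \<longrightarrow> leaper_jump a b (Vs ! i) (Vs ! Suc i))"

text \<open>For \<open>n > 0\<close> the board is nonempty, so \<open>last\<close> and \<open>hd\<close> are the actual end points. A tour with
  only two vertices may be closed: no minimal cycle length is imposed.\<close>

definition closed_euclidean_tour :: "nat \<Rightarrow> nat \<Rightarrow> nat \<Rightarrow> (real ^ 'k) list \<Rightarrow> bool" where
  "closed_euclidean_tour a b n Vs \<longleftrightarrow>
     euclidean_tour a b n Vs \<and> leaper_jump a b (last Vs) (hd Vs)"

abbreviation closed_wazir_tour :: "nat \<Rightarrow> (real ^ 'k) list \<Rightarrow> bool" where
  "closed_wazir_tour \<equiv> closed_euclidean_tour 0 1"

end

theory Submission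
  imports Defs
begin

text \<open>The reflected Gray code: from a tour of the face spanned by \<open>S\<close>, a tour of the face spanned by
  \<open>insert a S\<close> is obtained by walking through the given tour, stepping in direction \<open>a\<close>, and walking
  back through the translated tour. The two ends then differ by the unit vector in direction \<open>a\<close>,
  so the new tour is closed even when the given one is not (as for the one-vertex face).\<close>

definition cube_face :: "'k set \<Rightarrow> (real ^ 'k) set" where
  "cube_face S = {x. (\<forall>i\<in>S. x $ i = 0 \<or> x $ i = 1) \<and> (\<forall>i. i \<notin> S \<longrightarrow> x $ i = 0)}"

lemma cube_face_empty: "cube_face {} = {0}"
  by (auto simp: cube_face_def vec_eq_iff)

lemma cube_face_UNIV: "cube_face UNIV = board 2"
proof -
  have "{0..<2} = {0, 1::nat}" by auto
  then show ?thesis by (auto simp: cube_face_def board_def)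
qed

lemma cube_face_insert:
  assumes "a \<notin> S"
  shows "cube_face (insert a S) = cube_face S \<union> (\<lambda>v. v + axis a 1) ` cube_face S"
proof (intro equalityI subsetI)
  fix x assume x: "x \<in> cube_face (insert a S)"
  show "x \<in> cube_face S \<union> (\<lambda>v. v + axis a 1) ` cube_face S"
  proof (cases "x $ a = 0")
    case True
    with x show ?thesis by (auto simp: cube_face_def)
  next
    case False
    with x assms have "x - axis a 1 \<in> cube_face S"
      by (auto simp: cube_face_def axis_def)
    then show ?thesis by (intro UnI2 image_eqI[of _ _ "x - axis a 1"]) auto
  qed
next
  fix x assume "x \<in> cube_face S \<union> (\<lambda>v. v + axis a 1) ` cube_face S"
  with assms show "x \<in> cube_face (insert a S)"
    by (auto simp: cube_face_def axis_def; blast)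
qed

text \<open>The coordinate \<open>a\<close> tells the two halves apart: it is 0 on the face and 1 on
  the translate.\<close>

lemma cube_face_Int_translate:
  assumes "a \<notin> S"
  shows "cube_face S \<inter> (\<lambda>v. v + axis a 1) ` cube_face S = {}"
  using assms by (auto simp: cube_face_def)

text \<open>Inducting on the set of free coordinates keeps all faces in one ambient space. The
  closing condition excludes \<open>S = {}\<close>, whose single vertex is at distance 0 from
  itself.\<close>

lemma gray_code_exists:
  fixes S :: "'k::finite set"
  shows "\<exists>Vs. distinct Vs \<and> set Vs = cube_face S \<and> length Vs = 2 ^ card S \<and>
    successively (\<lambda>v w. dist v w = 1) Vs \<and>
    (S \<noteq> {} \<longrightarrow> dist (last Vs) (hd Vs) = 1)"
proof (induction S rule: finite_induct[OF finite])
  case 1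
  show ?case by (rule exI[of _ "[0]"]) (simp add: cube_face_empty)
next
  case (2 a S)
  then obtain Vs where Vs: "distinct Vs" "set Vs = cube_face S" "length Vs = 2 ^ card S"
    "successively (\<lambda>v w. dist v w = 1) Vs"
    by blast
  then have ne: "Vs \<noteq> []" by auto
  define Ws where "Ws = map (\<lambda>v. v + axis a 1) Vs"
  have step: "dist v (v + axis a 1) = 1" for v :: "real ^ 'k"
    by (simp add: dist_norm)
  have "distinct (Vs @ rev Ws)"
    using Vs cube_face_Int_translate[OF 2(2)] by (auto simp: Ws_def distinct_map)
  moreover have "set (Vs @ rev Ws) = cube_face (insert a S)"
    using Vs by (simp add: Ws_def cube_face_insert[OF 2(2)])
  moreover have "length (Vs @ rev Ws) = 2 ^ card (insert a S)"
    using Vs 2 by (simp add: Ws_def)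
  \<comment> \<open>Translation is an isometry and \<open>dist\<close> is symmetric, so the reversed
    copy is a path; the junction joins \<open>last Vs\<close> to its own translate.\<close>
  moreover have "successively (\<lambda>v w. dist v w = 1) (Vs @ rev Ws)"
    using Vs ne step
    by (simp add: Ws_def successively_append_iff successively_map hd_rev last_map dist_commute)
  \<comment> \<open>Reversal puts the translate of \<open>hd Vs\<close> at the end.\<close>
  moreover have "dist (last (Vs @ rev Ws)) (hd (Vs @ rev Ws)) = 1"
    using ne step[of "hd Vs"] by (simp add: Ws_def last_rev hd_map dist_commute)
  ultimately show ?case by blast
qed

theorem theorem3p1:
  shows "\<exists>Vs :: (real ^ 'k) list.
    closed_wazir_tour 2 Vs \<and>
    length Vs = 2 ^ CARD('k) \<and>
    (\<forall>i. Suc i < 2 ^ CARD('k) \<longrightarrow> norm (Vs ! i - Vs ! Suc i) = 1) \<and>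
    norm (Vs ! (2 ^ CARD('k) - 1) - Vs ! 0) = 1"
proof -
  obtain Vs :: "(real ^ 'k) list" where Vs: "distinct Vs" "set Vs = board 2"
    "length Vs = 2 ^ CARD('k)" "successively (\<lambda>v w. dist v w = 1) Vs"
    "dist (last Vs) (hd Vs) = 1"
    \<comment> \<open>\<open>UNIV\<close> is nonempty, so the closing condition applies.\<close>
    using gray_code_exists[of "UNIV :: 'k set"] by (auto simp: cube_face_UNIV)
  have steps: "dist (Vs ! i) (Vs ! Suc i) = 1" if "Suc i < 2 ^ CARD('k)" for i
    using Vs(3,4) that by (simp add: successively_conv_nth)
  have "Vs \<noteq> []" using Vs(3) by auto
  then have "norm (Vs ! (2 ^ CARD('k) - 1) - Vs ! 0) = 1"
    using Vs(3,5) by (simp add: last_conv_nth hd_conv_nth dist_norm)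
  with Vs steps show ?thesis
    by (intro exI[of _ Vs])
      (simp add: closed_euclidean_tour_def euclidean_tour_def leaper_jump_def flip: dist_norm)
qed

end
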